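(* Let $\{f_i\}_{i\in I}\subset\mathcal H$ be an adaptive resolution frame (AR-frame) for a separable Hilbert space $\mathcal H$ with frame bounds $A,B>0$, positive weights $\{\lambda_i\}_{i\in I}$ and partition $I=\bigcup_{k=1}^\infty I_k$, such that $\mathcal H=\bigoplus_{k=1}^\infty \mathcal H_k$ is an orthogonal decomposition, where $\mathcal H_k=\overline{\operatorname{span}}\{f_i: i\in I_k\}$, and each $\{f_i\}_{i\in I_k}$ is a frame for $\mathcal H_k$. Let the weighted analysis operator $T_1:\mathcal H\to\ell^2(I)$ be defined by $$T_1(x)=(\sqrt{\lambda_i}\,\langle x,f_i\rangle)_{i\in I},$$ and suppose $\{g_i\}_{i\in I}\subset\mathcal H$ is another sequence with the same weights and partition, with weighted analysis operator $T_2:\mathcal H\to\ell^2(I)$, $$T_2(x)=(\sqrt{\lambda_i}\,\langle x,g_i\rangle)_{i\in I}.$$ Define the perturbation operator $E:=T_1-T_2$. (i) If $\|E\|<\sqrt A$, then $\{g_i\}_{i\in I}$ is also an AR-frame with the same weights and partition, and its frame bounds are $(\sqrt A-\|E\|)^2$ and $(\sqrt B+\|E\|)^2$. (ii) If, in addition, the perturbation satisfies $\|E\|<\sqrt{B+A}-\sqrt B$, then the canonical reconstruction operator $R_g=S_g^{-1}T_2^*$ can be expressed as a convergent Neumann series perturbation of $R_f=S_f^{-1}T_1^*$, i.e. $$R_g=\sum_{n=0}^\infty(-S_f^{-1}\Delta S)^n\bigl(R_f-S_f^{-1}E^*\bigr),$$ where $S_f=T_1^*T_1$ and $S_g=T_2^*T_2$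 are the AR-frame operators for $\{f_i\}_{i\in I}$ and $\{g_i\}_{i\in I}$, respectively, and $\Delta S:=S_g-S_f$.
   Context: $\mathcal H$ is a separable Hilbert space with inner product $\langle\cdot,\cdot\rangle$ and norm $\|\cdot\|$; $I$ is a countable index set; $\|E\|$ is the operator norm and $*$ denotes the Hilbert space adjoint. AR-frame: a family $\{f_i\}_{i\in I}\subset\mathcal H$, equipped with positive weights $\{\lambda_i\}_{i\in I}$ and a partition $I=\bigcup_{k=1}^\infty I_k$ with $I_k\cap I_j=\emptyset$ for $k\ne j$, is an adaptive resolution frame (AR-frame) for $\mathcal H$ if there exist constants $A,B>0$ such that $$A\|x\|^2\le \sum_{k=1}^\infty\sum_{i\in I_k}\lambda_i|\langle x,f_i\rangle|^2\le B\|x\|^2\qquad\text{for all }x\in\mathcal H.$$ Any constants $A,B$ for which this holds are called (lower and upper) frame bounds; they are not required to be optimal. The AR-frame operator of an AR-frame is bounded, self-adjoint, positive and invertible on $\mathcal H$. *)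

theory Defs
  imports "HOL-Analysis.Analysis"
begin

section \<open>Scalars\<close>

text \<open>
  The scalar field of a Hilbert space is \<open>\<real>\<close> or \<open>\<complex>\<close>; the following class treats both at once
  (its axioms admit no other field). \<open>scnj\<close> is the conjugation (the identity on the reals).
\<close>

class rc_field = real_normed_field + banach +
  fixes scnj :: "'a \<Rightarrow> 'a"
  assumes scnj_add: "scnj (x + y) = scnj x + scnj y"
    and scnj_mult: "scnj (x * y) = scnj x * scnj y"
    and scnj_scnj: "scnj (scnj x) = x"
    and add_scnj: "\<exists>r. x + scnj x = r *\<^sub>R 1"
    and mult_scnj_scaleR: "x * scnj x = (norm x)\<^sup>2 *\<^sub>R 1"

instantiation real :: rc_field
begin
definition "scnj_real (x::real) = x"
instance by standard (auto simp: scnj_real_def power2_eq_square)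
end

instantiation complex :: rc_field
begin
definition "scnj_complex = cnj"
instance
proof
  fix x :: complex
  show "\<exists>r. x + scnj x = r *\<^sub>R 1"
    by (intro exI[of _ "2 * Re x"]) (simp add: scnj_complex_def complex_eq_iff)
  show "x * scnj x = (norm x)\<^sup>2 *\<^sub>R 1"
    unfolding scnj_complex_def scaleR_conv_of_real complex_norm_square by simp
qed (simp_all add: scnj_complex_def)
end

lemma mult_scnj: "x * scnj x = (of_real ((norm x)\<^sup>2) :: 'a::rc_field)"
  by (simp add: mult_scnj_scaleR of_real_def)

lemma scnj_0 [simp]: "scnj 0 = (0::'a::rc_field)"
  using scnj_add[of 0 "0::'a"] by simp

lemma norm_scnj [simp]: "norm (scnj x) = norm (x::'a::rc_field)"
proof (cases "x = 0")
  case False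
  have "norm x * norm (scnj x) = (norm x)\<^sup>2"
    unfolding norm_mult[symmetric] mult_scnj norm_of_real by simp
  then show ?thesis using False by (simp add: power2_eq_square)
qed simp

section \<open>Hilbert spaces\<close>

text \<open>
  Completeness and the norm come from the class \<^class>\<open>banach\<close>. The inner product is linear in
  its first argument.
\<close>

locale hilbert_space = vector_space scl
  for scl :: "'k::rc_field \<Rightarrow> 'h::banach \<Rightarrow> 'h" +
  fixes ip :: "'h \<Rightarrow> 'h \<Rightarrow> 'k"
  assumes scl_of_real: "scl (of_real r) x = r *\<^sub>R x"
    and ip_add_left: "ip (x + y) z = ip x z + ip y z"
    and ip_scl_left: "ip (scl c x) y = c * ip x y"
    and ip_commute: "ip y x = scnj (ip x y)"
    and ip_self: "ip x x = of_real ((norm x)\<^sup>2)"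

definition hilbert_adjoint ::
    "('h \<Rightarrow> 'h \<Rightarrow> 'k) \<Rightarrow> ('l \<Rightarrow> 'l \<Rightarrow> 'k) \<Rightarrow> ('h::real_normed_vector \<Rightarrow>\<^sub>L 'l::real_normed_vector) \<Rightarrow> ('l \<Rightarrow>\<^sub>L 'h)"
  where "hilbert_adjoint ipH ipL T = (THE S. \<forall>x y. ipL (blinfun_apply T x) y = ipH x (blinfun_apply S y))"

definition blinfun_inverse :: "('a::real_normed_vector \<Rightarrow>\<^sub>L 'b::real_normed_vector) \<Rightarrow> ('b \<Rightarrow>\<^sub>L 'a)"
  where "blinfun_inverse S = (THE R. R o\<^sub>L S = id_blinfun \<and> S o\<^sub>L R = id_blinfun)"

primrec blinfun_power :: "('a::real_normed_vector \<Rightarrow>\<^sub>L 'a) \<Rightarrow> nat \<Rightarrow> ('a \<Rightarrow>\<^sub>L 'a)"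
  where
    "blinfun_power D 0 = id_blinfun"
  | "blinfun_power D (Suc n) = D o\<^sub>L blinfun_power D n"

definition orthogonal_decomposition ::
    "('h::banach \<Rightarrow> 'h \<Rightarrow> 'k::zero) \<Rightarrow> (nat \<Rightarrow> 'h set) \<Rightarrow> bool"
  where "orthogonal_decomposition ip H \<longleftrightarrow>
    (\<forall>j k. j \<noteq> k \<longrightarrow> (\<forall>x\<in>H j. \<forall>y\<in>H k. ip x y = 0)) \<and>
    (\<forall>x. \<exists>y. (\<forall>k. y k \<in> H k) \<and> y sums x)"

section \<open>The space of square-summable families\<close>

definition square_summable :: "('i \<Rightarrow> 'k::real_normed_vector) \<Rightarrow> bool"
  where "square_summable x \<longleftrightarrow> (\<lambda>i. (norm (x i))\<^sup>2) summable_on UNIV"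

lemma square_summable_0: "square_summable (\<lambda>_. 0)"
  by (simp add: square_summable_def)

lemma square_summable_comparison:
  fixes x :: "'i \<Rightarrow> 'k::real_normed_vector"
  assumes "a summable_on UNIV" "\<And>i. (norm (x i))\<^sup>2 \<le> a i"
  shows "square_summable x"
  unfolding square_summable_def
  by (rule summable_on_comparison_test[OF assms(1)]) (use assms(2) in auto)

lemma square_summable_add:
  assumes "square_summable x" "square_summable y"
  shows "square_summable (\<lambda>i. x i + y i)"
proof (rule square_summable_comparison)
  show "(\<lambda>i. 2 * ((norm (x i))\<^sup>2 + (norm (y i))\<^sup>2)) summable_on UNIV"
    using assms unfolding square_summable_def
    by (intro summable_on_cmult_right summable_on_add)
next
  fix i
  have "(norm (x i + y i))\<^sup>2 \<le> (norm (x i) + norm (y i))\<^sup>2"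
    by (simp add: norm_triangle_ineq power_mono)
  also have "\<dots> \<le> 2 * ((norm (x i))\<^sup>2 + (norm (y i))\<^sup>2)"
    using sum_squares_bound[of "norm (x i)" "norm (y i)"] by (simp add: power2_sum)
  finally show "(norm (x i + y i))\<^sup>2 \<le> 2 * ((norm (x i))\<^sup>2 + (norm (y i))\<^sup>2)" .
qed

lemma square_summable_mult:
  assumes "square_summable x" "\<And>i. norm (y i) = c * norm (x i)"
  shows "square_summable y"
proof (rule square_summable_comparison)
  show "(\<lambda>i. c\<^sup>2 * (norm (x i))\<^sup>2) summable_on UNIV"
    using assms(1) unfolding square_summable_def by (intro summable_on_cmult_right)
qed (simp add: assms(2) power_mult_distrib)

typedef (overloaded) ('i, 'k::real_normed_vector) ell2 = "{x :: 'i \<Rightarrow> 'k. square_summable x}"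
  morphisms ell2_apply Abs_ell2
  using square_summable_0 by blast

setup_lifting type_definition_ell2

instantiation ell2 :: (type, real_normed_vector) real_vector
begin
lift_definition zero_ell2 :: "('a, 'b) ell2" is "\<lambda>_. 0" by (rule square_summable_0)
lift_definition plus_ell2 :: "('a, 'b) ell2 \<Rightarrow> ('a, 'b) ell2 \<Rightarrow> ('a, 'b) ell2"
  is "\<lambda>x y i. x i + y i" by (rule square_summable_add)
lift_definition uminus_ell2 :: "('a, 'b) ell2 \<Rightarrow> ('a, 'b) ell2"
  is "\<lambda>x i. - x i" by (erule square_summable_mult[where c = 1]) simp
lift_definition minus_ell2 :: "('a, 'b) ell2 \<Rightarrow> ('a, 'b) ell2 \<Rightarrow> ('a, 'b) ell2"
  is "\<lambda>x y i. x i - y i"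
  subgoal for x y
    using square_summable_add[of x "\<lambda>i. - y i"] square_summable_mult[of y "\<lambda>i. - y i" 1] by simp
  done
lift_definition scaleR_ell2 :: "real \<Rightarrow> ('a, 'b) ell2 \<Rightarrow> ('a, 'b) ell2"
  is "\<lambda>r x i. r *\<^sub>R x i"
  subgoal for r x by (erule square_summable_mult[where c = "\<bar>r\<bar>"]) simp
  done
instance
  by standard (transfer; simp add: fun_eq_iff algebra_simps)+
end

lemma square_summable_ell2 [simp]: "square_summable (ell2_apply x)"
  using ell2_apply by blast

lemma summable_on_ell2: "(\<lambda>i. (norm (ell2_apply x i))\<^sup>2) summable_on A"
  using square_summable_ell2[of x] unfolding square_summable_def
  by (rule summable_on_subset_banach) simp

instantiation ell2 :: (type, real_normed_vector) real_normed_vector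
begin

definition norm_ell2 :: "('a, 'b) ell2 \<Rightarrow> real"
  where "norm_ell2 x = sqrt (\<Sum>\<^sub>\<infinity>i. (norm (ell2_apply x i))\<^sup>2)"
definition dist_ell2 :: "('a, 'b) ell2 \<Rightarrow> ('a, 'b) ell2 \<Rightarrow> real"
  where "dist_ell2 x y = norm (x - y)"
definition sgn_ell2 :: "('a, 'b) ell2 \<Rightarrow> ('a, 'b) ell2"
  where "sgn_ell2 x = x /\<^sub>R norm x"
definition uniformity_ell2 :: "(('a, 'b) ell2 \<times> ('a, 'b) ell2) filter"
  where "uniformity_ell2 = (INF e\<in>{0 <..}. principal {(x, y). dist x y < e})"
definition open_ell2 :: "('a, 'b) ell2 set \<Rightarrow> bool"
  where "open_ell2 U = (\<forall>x\<in>U. \<forall>\<^sub>F (x', y) in uniformity. x' = x \<longrightarrow> y \<in> U)"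

lemma ell2_norm_ge_L2_set:
  assumes "finite F"
  shows "L2_set (\<lambda>i. norm (ell2_apply x i)) F \<le> norm x"
  unfolding L2_set_def norm_ell2_def
  by (intro real_sqrt_le_mono finite_sum_le_infsum summable_on_ell2) (use assms in auto)

lemma ell2_norm_leI:
  assumes "0 \<le> c" "\<And>F. finite F \<Longrightarrow> L2_set (\<lambda>i. norm (ell2_apply x i)) F \<le> c"
  shows "norm x \<le> c"
proof -
  have "(\<Sum>i\<in>F. (norm (ell2_apply x i))\<^sup>2) \<le> c\<^sup>2" if "finite F" for F
    using assms(2)[OF that] unfolding L2_set_def by (rule sqrt_le_D)
  then have "(\<Sum>\<^sub>\<infinity>i. (norm (ell2_apply x i))\<^sup>2) \<le> c\<^sup>2"
    by (intro infsum_le_finite_sums summable_on_ell2) auto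
  then show ?thesis
    unfolding norm_ell2_def using assms(1) by (rule real_le_lsqrt[rotated])
qed

instance
proof
  fix x y :: "('a, 'b) ell2" and r :: real
  show "dist x y = norm (x - y)" by (rule dist_ell2_def)
  show "sgn x = x /\<^sub>R norm x" by (rule sgn_ell2_def)
  show "uniformity = (INF e\<in>{0 <..}. principal {(x, y :: ('a, 'b) ell2). dist x y < e})"
    by (rule uniformity_ell2_def)
  show "open U = (\<forall>x\<in>U. \<forall>\<^sub>F (x', y) in uniformity. x' = x \<longrightarrow> y \<in> U)"
    for U :: "('a, 'b) ell2 set" by (rule open_ell2_def)
  show "(norm x = 0) = (x = 0)"
  proof
    assume "norm x = 0"
    have "ell2_apply x i = 0" for i
      using ell2_norm_ge_L2_set[of "{i}" x] \<open>norm x = 0\<close> by simp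
    then show "x = 0" by transfer auto
  qed (simp add: norm_ell2_def zero_ell2.rep_eq)
  have nonneg: "0 \<le> norm z" for z :: "('a, 'b) ell2"
    by (simp add: norm_ell2_def infsum_nonneg)
  show "norm (x + y) \<le> norm x + norm y"
  proof (rule ell2_norm_leI)
    fix F :: "'a set" assume F: "finite F"
    have "L2_set (\<lambda>i. norm (ell2_apply (x + y) i)) F
        \<le> L2_set (\<lambda>i. norm (ell2_apply x i) + norm (ell2_apply y i)) F"
      by (rule L2_set_mono) (auto simp: plus_ell2.rep_eq norm_triangle_ineq)
    also have "\<dots> \<le> L2_set (\<lambda>i. norm (ell2_apply x i)) F + L2_set (\<lambda>i. norm (ell2_apply y i)) F"
      by (rule L2_set_triangle_ineq)
    also have "\<dots> \<le> norm x + norm y"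
      using ell2_norm_ge_L2_set[OF F, of x] ell2_norm_ge_L2_set[OF F, of y] by (rule add_mono)
    finally show "L2_set (\<lambda>i. norm (ell2_apply (x + y) i)) F \<le> norm x + norm y" .
  qed (simp add: nonneg)
  show "norm (r *\<^sub>R x) = \<bar>r\<bar> * norm x"
    by (simp add: norm_ell2_def scaleR_ell2.rep_eq power_mult_distrib infsum_cmult_right'
        real_sqrt_mult)
qed

end

lemma norm_ell2_apply_le: "norm (ell2_apply x i) \<le> norm x"
  using ell2_norm_ge_L2_set[of "{i}" x] by simp

instance ell2 :: (type, banach) banach
proof
  fix X :: "nat \<Rightarrow> ('a, 'b) ell2"
  assume X: "Cauchy X"
  have "Cauchy (\<lambda>n. ell2_apply (X n) i)" for i
  proof (rule metric_CauchyI)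
    fix e :: real assume "e > 0"
    then obtain M where M: "\<And>m n. m \<ge> M \<Longrightarrow> n \<ge> M \<Longrightarrow> dist (X m) (X n) < e"
      using metric_CauchyD[OF X] by metis
    have "dist (ell2_apply (X m) i) (ell2_apply (X n) i) \<le> dist (X m) (X n)" for m n
      using norm_ell2_apply_le[of "X m - X n" i] by (simp add: dist_norm minus_ell2.rep_eq)
    then show "\<exists>M. \<forall>m\<ge>M. \<forall>n\<ge>M. dist (ell2_apply (X m) i) (ell2_apply (X n) i) < e"
      using M by (meson le_less_trans)
  qed
  then have "\<exists>l. (\<lambda>n. ell2_apply (X n) i) \<longlonglongrightarrow> l" for i
    by (simp add: Cauchy_convergent_iff convergent_def)
  then obtain l where l: "\<And>i. (\<lambda>n. ell2_apply (X n) i) \<longlonglongrightarrow> l i" by metis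
  have tail: "L2_set (\<lambda>i. norm (ell2_apply (X n) i - l i)) F \<le> e"
    if "finite F" and M: "\<And>m n. m \<ge> M \<Longrightarrow> n \<ge> M \<Longrightarrow> dist (X m) (X n) < e" and "n \<ge> M" for F M e n
  proof (rule tendsto_upperbound)
    show "(\<lambda>m. L2_set (\<lambda>i. norm (ell2_apply (X n) i - ell2_apply (X m) i)) F)
        \<longlonglongrightarrow> L2_set (\<lambda>i. norm (ell2_apply (X n) i - l i)) F"
      unfolding L2_set_def by (intro tendsto_intros l)
    show "\<forall>\<^sub>F m in sequentially. L2_set (\<lambda>i. norm (ell2_apply (X n) i - ell2_apply (X m) i)) F \<le> e"
      unfolding eventually_sequentially
    proof (intro exI allI impI)
      fix m assume "M \<le> m"
      have "L2_set (\<lambda>i. norm (ell2_apply (X n - X m) i)) F \<le> norm (X n - X m)"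
        using that(1) by (rule ell2_norm_ge_L2_set)
      also have "\<dots> \<le> e" using M[OF \<open>n \<ge> M\<close> \<open>M \<le> m\<close>] by (simp add: dist_norm)
      finally show "L2_set (\<lambda>i. norm (ell2_apply (X n) i - ell2_apply (X m) i)) F \<le> e"
        by (simp add: minus_ell2.rep_eq)
    qed
  qed simp
  have diff: "square_summable (\<lambda>i. ell2_apply (X n) i - l i)"
    if M: "\<And>m n. m \<ge> M \<Longrightarrow> n \<ge> M \<Longrightarrow> dist (X m) (X n) < e" and "n \<ge> M" for M e n
    unfolding square_summable_def
  proof (rule nonneg_bdd_above_summable_on)
    show "bdd_above (sum (\<lambda>i. (norm (ell2_apply (X n) i - l i))\<^sup>2) ` {F. F \<subseteq> UNIV \<and> finite F})"
    proof (rule bdd_aboveI2)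
      fix F :: "'a set" assume "F \<in> {F. F \<subseteq> UNIV \<and> finite F}"
      then show "(\<Sum>i\<in>F. (norm (ell2_apply (X n) i - l i))\<^sup>2) \<le> e\<^sup>2"
        using tail[OF _ that] unfolding L2_set_def by (intro sqrt_le_D) auto
    qed
  qed simp
  obtain M where M: "\<And>m n. m \<ge> M \<Longrightarrow> n \<ge> M \<Longrightarrow> dist (X m) (X n) < 1"
    using metric_CauchyD[OF X zero_less_one] by metis
  have "square_summable (\<lambda>i. ell2_apply (X M) i - l i)"
    by (rule diff[OF M order_refl])
  then have "square_summable (\<lambda>i. l i - ell2_apply (X M) i)"
    by (rule square_summable_mult[where c = 1]) (simp add: norm_minus_commute)
  from square_summable_add[OF this square_summable_ell2[of "X M"]]
  have "square_summable l" by simp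
  then have l_apply: "ell2_apply (Abs_ell2 l) = l" by (simp add: Abs_ell2_inverse)
  have "X \<longlonglongrightarrow> Abs_ell2 l"
  proof (rule metric_LIMSEQ_I)
    fix e :: real assume "e > 0"
    then obtain M where M: "\<And>m n. m \<ge> M \<Longrightarrow> n \<ge> M \<Longrightarrow> dist (X m) (X n) < e / 2"
      using metric_CauchyD[OF X, of "e / 2"] by (metis half_gt_zero)
    have "dist (X n) (Abs_ell2 l) \<le> e / 2" if "n \<ge> M" for n
      unfolding dist_norm
      by (rule ell2_norm_leI)
        (use \<open>e > 0\<close> tail[OF _ M that] in \<open>auto simp: minus_ell2.rep_eq l_apply\<close>)
    then show "\<exists>no. \<forall>n\<ge>no. dist (X n) (Abs_ell2 l) < e"
      using \<open>e > 0\<close> by (intro exI[of _ M]) fastforce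
  qed
  then show "convergent X" by (rule convergentI)
qed

lift_definition ell2_scale :: "'k::rc_field \<Rightarrow> ('i, 'k) ell2 \<Rightarrow> ('i, 'k) ell2"
  is "\<lambda>c x i. c * x i"
  subgoal for c x by (erule square_summable_mult[where c = "norm c"]) (simp add: norm_mult)
  done

definition ell2_ip :: "('i, 'k::rc_field) ell2 \<Rightarrow> ('i, 'k) ell2 \<Rightarrow> 'k"
  where "ell2_ip x y = (\<Sum>\<^sub>\<infinity>i. ell2_apply x i * scnj (ell2_apply y i))"

lemma summable_on_ell2_ip:
  fixes x y :: "('i, 'k::rc_field) ell2"
  shows "(\<lambda>i. ell2_apply x i * scnj (ell2_apply y i)) summable_on UNIV"
proof (rule abs_summable_summable)
  have "(\<lambda>i. (norm (ell2_apply x i))\<^sup>2 + (norm (ell2_apply y i))\<^sup>2) summable_on UNIV"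
    by (intro summable_on_add summable_on_ell2)
  then show "(\<lambda>i. norm (ell2_apply x i * scnj (ell2_apply y i))) summable_on UNIV"
  proof (rule summable_on_comparison_test)
    fix i
    have "2 * (norm (ell2_apply x i) * norm (ell2_apply y i))
        \<le> (norm (ell2_apply x i))\<^sup>2 + (norm (ell2_apply y i))\<^sup>2"
      using sum_squares_bound[of "norm (ell2_apply x i)" "norm (ell2_apply y i)"] by simp
    moreover have "0 \<le> norm (ell2_apply x i) * norm (ell2_apply y i)" by simp
    ultimately show "norm (ell2_apply x i * scnj (ell2_apply y i))
        \<le> (norm (ell2_apply x i))\<^sup>2 + (norm (ell2_apply y i))\<^sup>2"
      unfolding norm_mult norm_scnj by linarith
  qed simp
qed

lemma bounded_linear_scnj: "bounded_linear (scnj :: 'k::rc_field \<Rightarrow> 'k)"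
proof (rule bounded_linear_intro[where K = 1])
  fix r :: real and x :: 'k
  have "scnj (of_real r) = (of_real r :: 'k)"
  proof (cases "r = 0")
    case False
    have "of_real r * scnj (of_real r) = (of_real r * of_real r :: 'k)"
      using mult_scnj[of "of_real r :: 'k"] by (simp add: power2_eq_square)
    then show ?thesis using False by simp
  qed simp
  then show "scnj (r *\<^sub>R x) = r *\<^sub>R scnj x"
    by (simp add: scaleR_conv_of_real scnj_mult)
qed (simp_all add: scnj_add)

interpretation ell2: hilbert_space ell2_scale "ell2_ip :: ('i, 'k::rc_field) ell2 \<Rightarrow> ('i, 'k) ell2 \<Rightarrow> 'k"
proof
  fix x y z :: "('i, 'k) ell2" and c d :: 'k and r :: real
  show "ell2_scale c (x + y) = ell2_scale c x + ell2_scale c y"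
    and "ell2_scale (c + d) x = ell2_scale c x + ell2_scale d x"
    and "ell2_scale c (ell2_scale d x) = ell2_scale (c * d) x"
    and "ell2_scale 1 x = x"
    and "ell2_scale (of_real r) x = r *\<^sub>R x"
    by (transfer; simp add: fun_eq_iff algebra_simps scaleR_conv_of_real)+
  show "ell2_ip (x + y) z = ell2_ip x z + ell2_ip y z"
    unfolding ell2_ip_def plus_ell2.rep_eq distrib_right
    by (rule infsum_add) (rule summable_on_ell2_ip)+
  show "ell2_ip (ell2_scale c x) y = c * ell2_ip x y"
    unfolding ell2_ip_def ell2_scale.rep_eq mult.assoc by (rule infsum_cmult_right')
  show "ell2_ip y x = scnj (ell2_ip x y)"
    using infsumI[OF has_sum_bounded_linear[OF bounded_linear_scnj
        has_sum_infsum[OF summable_on_ell2_ip[of x y]]]]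
    by (simp add: ell2_ip_def scnj_mult scnj_scnj mult.commute)
  show "ell2_ip x x = of_real ((norm x)\<^sup>2)"
    using infsumI[OF has_sum_bounded_linear[OF bounded_linear_of_real[where 'a = 'k]
        has_sum_infsum[OF summable_on_ell2[of x UNIV]]]]
    unfolding ell2_ip_def mult_scnj norm_ell2_def
    by (subst real_sqrt_pow2) (simp_all add: infsum_nonneg)
qed

section \<open>Frames\<close>

definition is_frame_for ::
    "('h::real_normed_vector \<Rightarrow> 'h \<Rightarrow> 'k::rc_field) \<Rightarrow> 'i set \<Rightarrow> ('i \<Rightarrow> 'h) \<Rightarrow> 'h set \<Rightarrow> bool"
  where "is_frame_for ip J f M \<longleftrightarrow>
    f ` J \<subseteq> M \<and>
    (\<exists>a b. 0 < a \<and> 0 < b \<and> (\<forall>x\<in>M.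
      ennreal (a * (norm x)\<^sup>2) \<le> (\<Sum>\<^sub>\<infinity>i\<in>J. ennreal ((norm (ip x (f i)))\<^sup>2)) \<and>
      (\<Sum>\<^sub>\<infinity>i\<in>J. ennreal ((norm (ip x (f i)))\<^sup>2)) \<le> ennreal (b * (norm x)\<^sup>2)))"

text \<open>
  The blocks of the partition are indexed from \<open>0\<close> and may be empty. The double series is taken in
  \<open>[0, \<infinity>]\<close>, so the upper bound includes its convergence.
\<close>

definition ar_frame ::
    "('h::real_normed_vector \<Rightarrow> 'h \<Rightarrow> 'k::rc_field) \<Rightarrow> ('i \<Rightarrow> real) \<Rightarrow> 'i set \<Rightarrow> (nat \<Rightarrow> 'i set)
      \<Rightarrow> ('i \<Rightarrow> 'h) \<Rightarrow> real \<Rightarrow> real \<Rightarrow> bool"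
  where "ar_frame ip w I P f A B \<longleftrightarrow>
    countable I \<and> (\<forall>i\<in>I. 0 < w i) \<and>
    I = (\<Union>k. P k) \<and> disjoint_family P \<and>
    0 < A \<and> 0 < B \<and>
    (\<forall>x. ennreal (A * (norm x)\<^sup>2) \<le> (\<Sum>k. \<Sum>\<^sub>\<infinity>i\<in>P k. ennreal (w i * (norm (ip x (f i)))\<^sup>2)) \<and>
         (\<Sum>k. \<Sum>\<^sub>\<infinity>i\<in>P k. ennreal (w i * (norm (ip x (f i)))\<^sup>2)) \<le> ennreal (B * (norm x)\<^sup>2))"

text \<open>
  The space \<open>\<ell>\<^sup>2(I)\<close> of an index set \<open>I\<close> is realized inside \<open>\<ell>\<^sup>2\<close> of the whole index type, as the
  families vanishing outside \<open>I\<close>. Operators into it have the same norm in both readings, and their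
  adjoints are extended by \<open>0\<close> to the orthogonal complement.
\<close>

definition analysis_family ::
    "('h \<Rightarrow> 'h \<Rightarrow> 'k::rc_field) \<Rightarrow> ('i \<Rightarrow> real) \<Rightarrow> 'i set \<Rightarrow> ('i \<Rightarrow> 'h) \<Rightarrow> 'h \<Rightarrow> 'i \<Rightarrow> 'k"
  where "analysis_family ip w I f x = (\<lambda>i. if i \<in> I then of_real (sqrt (w i)) * ip x (f i) else 0)"

text \<open>
  This operator is meaningful when every \<open>analysis_family ip w I f x\<close> is square-summable: it is then
  automatically bounded, by the uniform boundedness principle.
\<close>

definition analysis_op ::
    "('h::real_normed_vector \<Rightarrow> 'h \<Rightarrow> 'k::rc_field) \<Rightarrow> ('i \<Rightarrow> real) \<Rightarrow> 'i set \<Rightarrow> ('i \<Rightarrow> 'h)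
      \<Rightarrow> ('h \<Rightarrow>\<^sub>L ('i, 'k) ell2)"
  where "analysis_op ip w I f = Blinfun (\<lambda>x. Abs_ell2 (analysis_family ip w I f x))"

end

theory Submission
  imports Defs
begin

text \<open>
  The frame inequality says that the analysis operator \<open>T\<close> satisfies
  \<open>sqrt A \<parallel>x\<parallel> \<le> \<parallel>T x\<parallel> \<le> sqrt B \<parallel>x\<parallel>\<close> (lemma \<open>ar_frame_iff\<close>). Since \<open>T2 = T1 - E\<close>, the triangle inequality
  moves the constants \<open>sqrt A\<close> and \<open>sqrt B\<close> by at most \<open>\<parallel>E\<parallel>\<close>, which is the first claim.

  For the second claim, put \<open>D = - Sf\<^sup>-\<^sup>1 \<Delta>S\<close>, so that \<open>Sg = Sf (id - D)\<close>. Taking adjoints in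
  \<open>T2 = T1 - E\<close> gives \<open>\<Delta>S = E* E - T1* E - E* T1\<close>, hence \<open>\<parallel>\<Delta>S\<parallel> \<le> 2 sqrt B \<parallel>E\<parallel> + \<parallel>E\<parallel>\<^sup>2\<close>. The hypothesis
  \<open>\<parallel>E\<parallel> < sqrt (B + A) - sqrt B\<close> makes this smaller than \<open>A\<close>, while \<open>\<parallel>Sf\<^sup>-\<^sup>1\<parallel> \<le> 1 / A\<close>; therefore \<open>\<parallel>D\<parallel> < 1\<close>, and
  \<open>Sg\<^sup>-\<^sup>1\<close> is the Neumann series of \<open>D\<close> followed on the right by \<open>Sf\<^sup>-\<^sup>1\<close>. Multiplying by
  \<open>T2* = T1* - E*\<close> gives the stated expansion.

  Adjoints and inverses are defined by definite descriptions, and an analysis operator by reading a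
  function as a bounded operator, so it has to be shown that such operators exist.
  Boundedness of the analysis operator is the uniform boundedness principle, obtained from the Baire
  category theorem (\<open>bounded_linear_into_ell2\<close>). Adjoints come from the Riesz representation theorem,
  which is proved by minimizing the norm on a hyperplane. The inverse of the frame operator comes
  from coercivity (\<open>coercive_invertible\<close>), itself a Neumann series argument.
\<close>

section \<open>Sums of nonnegative numbers\<close>

text \<open>
  The double sum defining an AR-frame is a single unordered sum over the index set: every finite set
  of indices lies in finitely many blocks, and in \<open>[0, \<infinity>]\<close> both sides are suprema of such finite
  sums. The order in which the blocks are listed is therefore immaterial.
\<close>

lemma suminf_infsum_ennreal:
  fixes a :: "'i \<Rightarrow> ennreal"
  assumes "disjoint_family P"
  shows "(\<Sum>k. \<Sum>\<^sub>\<infinity>i\<in>P k. a i) = (\<Sum>\<^sub>\<infinity>i\<in>(\<Union>k. P k). a i)"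
proof -
  have summ: "a summable_on J" for J
    by (rule nonneg_summable_on_complete) simp
  have part: "(\<Sum>k<n. \<Sum>\<^sub>\<infinity>i\<in>P k. a i) = (\<Sum>\<^sub>\<infinity>i\<in>(\<Union>k<n. P k). a i)" for n
  proof (induction n)
    case (Suc n)
    have "(\<Union>k<n. P k) \<inter> P n = {}"
    proof -
      have "P k \<inter> P n = {}" if "k < n" for k
        using assms that by (auto simp: disjoint_family_on_def)
      then show ?thesis by blast
    qed
    then show ?case
      using Suc infsum_Un_disjoint[OF summ summ, of "\<Union>k<n. P k" "P n"]
      by (simp add: lessThan_Suc Un_commute)
  qed simp
  show ?thesis
  proof (rule antisym)
    show "(\<Sum>k. \<Sum>\<^sub>\<infinity>i\<in>P k. a i) \<le> (\<Sum>\<^sub>\<infinity>i\<in>(\<Union>k. P k). a i)"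
      unfolding suminf_eq_SUP part
      by (intro SUP_least infsum_mono_neutral summ) auto
    show "(\<Sum>\<^sub>\<infinity>i\<in>(\<Union>k. P k). a i) \<le> (\<Sum>k. \<Sum>\<^sub>\<infinity>i\<in>P k. a i)"
      unfolding nonneg_infsum_complete[of "\<Union>k. P k" a, OF zero_le]
    proof (rule SUP_least, clarify)
      fix F assume F: "finite F" "F \<subseteq> (\<Union>k. P k)"
      then obtain h where h: "\<And>i. i \<in> F \<Longrightarrow> i \<in> P (h i)"
        by (metis UN_iff subsetD)
      from F(1) obtain n where n: "h ` F \<subseteq> {..<n}"
        using finite_nat_bounded by blast
      have "sum a F = (\<Sum>\<^sub>\<infinity>i\<in>F. a i)"
        using F(1) by simp
      also have "\<dots> \<le> (\<Sum>\<^sub>\<infinity>i\<in>(\<Union>k<n. P k). a i)"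
        by (rule infsum_mono_neutral[OF summ summ]) (use h n in auto)
      also have "\<dots> \<le> (\<Sum>k. \<Sum>\<^sub>\<infinity>i\<in>P k. a i)"
        unfolding part[symmetric] suminf_eq_SUP by (rule SUP_upper) simp
      finally show "sum a F \<le> (\<Sum>k. \<Sum>\<^sub>\<infinity>i\<in>P k. a i)" .
    qed
  qed
qed

lemma infsum_ennreal:
  fixes a :: "'i \<Rightarrow> real"
  assumes "a summable_on J" "\<And>i. i \<in> J \<Longrightarrow> 0 \<le> a i"
  shows "(\<Sum>\<^sub>\<infinity>i\<in>J. ennreal (a i)) = ennreal (\<Sum>\<^sub>\<infinity>i\<in>J. a i)"
proof -
  have "(\<Sum>\<^sub>\<infinity>i\<in>J. ennreal (a i)) = (SUP F\<in>{F. finite F \<and> F \<subseteq> J}. \<Sum>i\<in>F. ennreal (a i))"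
    by (rule nonneg_infsum_complete) simp
  also have "\<dots> = (SUP F\<in>{F. finite F \<and> F \<subseteq> J}. ennreal (sum a F))"
    by (intro SUP_cong refl sum_ennreal) (use assms(2) in auto)
  also have "\<dots> = ennreal (\<Sum>\<^sub>\<infinity>i\<in>J. a i)"
    by (rule infsum_nonneg_is_SUPREMUM_ennreal[symmetric]) (use assms in auto)
  finally show ?thesis .
qed

lemma summable_on_infsum_ennreal_finite:
  fixes a :: "'i \<Rightarrow> real"
  assumes fin: "(\<Sum>\<^sub>\<infinity>i\<in>J. ennreal (a i)) \<le> ennreal c" and nonneg: "\<And>i. i \<in> J \<Longrightarrow> 0 \<le> a i"
  shows "a summable_on J"
proof (rule nonneg_bdd_above_summable_on[OF nonneg])
  show "bdd_above (sum a ` {F. F \<subseteq> J \<and> finite F})"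
  proof (rule bdd_aboveI2)
    fix F assume "F \<in> {F. F \<subseteq> J \<and> finite F}"
    then have F: "finite F" "F \<subseteq> J" by auto
    have "ennreal (sum a F) = (\<Sum>i\<in>F. ennreal (a i))"
      by (rule sum_ennreal[symmetric]) (use F nonneg in auto)
    also have "\<dots> \<le> (\<Sum>\<^sub>\<infinity>i\<in>J. ennreal (a i))"
      unfolding nonneg_infsum_complete[of J "\<lambda>i. ennreal (a i)", OF zero_le]
      by (rule SUP_upper) (use F in auto)
    also have "\<dots> \<le> ennreal (max c 0)"
      using fin by (simp add: ennreal_max_0 max.commute)
    finally show "sum a F \<le> max c 0" 
      by (simp del: ennreal_max_0)
  qed
qed

section \<open>Geometry of Hilbert spaces\<close>

lemma scnj_scaleR: "scnj (r *\<^sub>R c) = r *\<^sub>R scnj (c :: 'k::rc_field)"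
  using bounded_linear.linear[OF bounded_linear_scnj] by (rule linear_cmul)

lemma scnj_of_real: "scnj (of_real r) = (of_real r :: 'k::rc_field)"
proof -
  have "scnj (1::'k) * scnj 1 = scnj 1 * 1"
    by (simp add: scnj_mult[symmetric])
  moreover have "scnj (1::'k) \<noteq> 0"
    using norm_scnj[of "1::'k"] by (metis norm_zero norm_one zero_neq_one)
  ultimately have "scnj (1::'k) = 1" by (metis mult_cancel_left)
  then show ?thesis by (simp add: of_real_def scnj_scaleR)
qed

context hilbert_space
begin

lemma ip_zero_left [simp]: "ip 0 y = 0"
  using ip_add_left[of 0 0 y] by simp

lemma ip_zero_right [simp]: "ip x 0 = 0"
  by (subst ip_commute) simp

lemma ip_add_right: "ip x (y + z) = ip x y + ip x z"
  by (metis ip_add_left ip_commute scnj_add)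

lemma ip_diff_left: "ip (x - y) z = ip x z - ip y z"
  using ip_add_left[of "x - y" y z] by (simp add: algebra_simps)

lemma ip_diff_right: "ip x (y - z) = ip x y - ip x z"
  using ip_add_right[of x "y - z" z] by (simp add: algebra_simps)

lemma ip_scl_right: "ip x (scl c y) = scnj c * ip x y"
  by (metis ip_scl_left ip_commute scnj_mult)

lemma ip_scaleR_left: "ip (r *\<^sub>R x) y = r *\<^sub>R ip x y"
  by (metis ip_scl_left scl_of_real scaleR_conv_of_real)

lemma ip_scaleR_right: "ip x (r *\<^sub>R y) = r *\<^sub>R ip x y"
  by (metis ip_scaleR_left ip_commute scnj_scaleR)

lemma norm_add_sq:
  "of_real ((norm (x + y))\<^sup>2) = of_real ((norm x)\<^sup>2) + ip x y + ip y x + of_real ((norm y)\<^sup>2)"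
  by (simp add: ip_self[symmetric] ip_add_left ip_add_right del: of_real_power)

lemma norm_diff_sq:
  "of_real ((norm (x - y))\<^sup>2) = of_real ((norm x)\<^sup>2) - ip x y - ip y x + of_real ((norm y)\<^sup>2)"
  by (simp add: ip_self[symmetric] ip_diff_left ip_diff_right del: of_real_power)

lemma parallelogram:
  fixes x y :: 'h
  shows "(norm (x + y))\<^sup>2 + (norm (x - y))\<^sup>2 = 2 * (norm x)\<^sup>2 + 2 * (norm y)\<^sup>2"
proof -
  have "(of_real ((norm (x + y))\<^sup>2 + (norm (x - y))\<^sup>2) :: 'k)
      = of_real (2 * (norm x)\<^sup>2 + 2 * (norm y)\<^sup>2)"
    using norm_add_sq[of x y] norm_diff_sq[of x y] by (simp del: of_real_power)
  then show ?thesis by (simp only: of_real_eq_iff)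
qed

text \<open>
  The squared distance from \<open>x\<close> to its orthogonal projection on the line through \<open>y\<close>. Nonnegativity of
  the left-hand side is the Cauchy--Schwarz inequality; in \<open>Riesz_representation\<close> the loss of norm on
  the right-hand side shows that a vector of minimal norm is orthogonal to the directions in which it
  may be moved.
\<close>

lemma norm_minus_projection:
  assumes "y \<noteq> 0"
  shows "(norm (x - scl (ip x y / of_real ((norm y)\<^sup>2)) y))\<^sup>2
    = (norm x)\<^sup>2 - (norm (ip x y))\<^sup>2 / (norm y)\<^sup>2"
proof -
  define n where "n = (norm y)\<^sup>2"
  have n: "n \<noteq> 0" using assms by (simp add: n_def)
  define c where "c = ip x y / of_real n"
  have scnj_n: "scnj (inverse (of_real n)) = (inverse (of_real n) :: 'k)"
    using scnj_of_real[of "inverse n"] by simp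
  have scnj_c: "scnj c = ip y x / of_real n"
    by (simp add: c_def divide_inverse scnj_mult scnj_n ip_commute[of y x])
  have prod: "ip x y * ip y x = of_real ((norm (ip x y))\<^sup>2)"
    unfolding ip_commute[of y x] by (rule mult_scnj)
  have "(of_real ((norm (x - scl c y))\<^sup>2) :: 'k)
      = of_real ((norm x)\<^sup>2) - scnj c * ip x y - c * ip y x + c * scnj c * of_real n"
    unfolding ip_self[symmetric] n_def
    by (simp add: ip_diff_left ip_diff_right ip_scl_left ip_scl_right algebra_simps)
  also have "\<dots> = of_real ((norm x)\<^sup>2) - ip x y * ip y x / of_real n"
    unfolding scnj_c using n by (simp add: c_def)
  also have "\<dots> = of_real ((norm x)\<^sup>2 - (norm (ip x y))\<^sup>2 / n)"
    unfolding prod by simp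
  finally show ?thesis
    by (simp only: of_real_eq_iff c_def n_def)
qed

lemma Cauchy_Schwarz: "norm (ip x y) \<le> norm x * norm y"
proof (cases "y = 0")
  case False
  have "0 \<le> (norm x)\<^sup>2 - (norm (ip x y))\<^sup>2 / (norm y)\<^sup>2"
    unfolding norm_minus_projection[OF False, symmetric] by simp
  then have "(norm (ip x y))\<^sup>2 \<le> (norm x * norm y)\<^sup>2"
    using False by (simp add: field_simps)
  then show ?thesis by (rule power2_le_imp_le) simp
qed simp

lemma bounded_linear_ip_left: "bounded_linear (\<lambda>x. ip x y)"
  by (rule bounded_linear_intro[where K = "norm y"])
    (simp_all add: ip_add_left ip_scaleR_left Cauchy_Schwarz)

lemma eqI_ip: "(\<And>z. ip z x = ip z y) \<Longrightarrow> x = y"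
proof -
  assume "\<And>z. ip z x = ip z y"
  then have "ip (x - y) (x - y) = 0" by (simp add: ip_diff_right)
  then show "x = y" by (simp add: ip_self)
qed

text \<open>
  Midpoints of \<open>K\<close> stay in \<open>K\<close>, so by the parallelogram law two elements whose norms are nearly
  minimal must be close to each other. A minimizing sequence is thus Cauchy.
\<close>

lemma min_norm_exists:
  fixes K :: "'h set"
  assumes "closed K" "convex K" "K \<noteq> {}"
  shows "\<exists>u\<in>K. \<forall>x\<in>K. norm u \<le> norm x"
proof -
  define d where "d = (INF x\<in>K. (norm x)\<^sup>2)"
  have bdd: "bdd_below ((\<lambda>x. (norm x)\<^sup>2) ` K)" by (rule bdd_belowI2[of _ 0]) simp
  have d_le: "d \<le> (norm x)\<^sup>2" if "x \<in> K" for x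
    unfolding d_def using bdd that by (rule cINF_lower)
  have "\<exists>x\<in>K. (norm x)\<^sup>2 < d + 1 / Suc n" for n
    using cInf_lessD[of "(\<lambda>x. (norm x)\<^sup>2) ` K" "d + 1 / Suc n"] assms(3) by (auto simp: d_def)
  then obtain X where X: "\<And>n. X n \<in> K" "\<And>n. (norm (X n))\<^sup>2 < d + 1 / Suc n"
    by metis
  have gap: "(norm (X m - X n))\<^sup>2 \<le> 2 / Suc m + 2 / Suc n" for m n
  proof -
    have "(1/2) *\<^sub>R X m + (1/2) *\<^sub>R X n \<in> K"
      by (rule convexD[OF assms(2) X(1) X(1)]) auto
    then have "d \<le> (norm ((1/2) *\<^sub>R (X m + X n)))\<^sup>2"
      unfolding scaleR_add_right by (rule d_le)
    then have "4 * d \<le> (norm (X m + X n))\<^sup>2" by (simp add: power_divide)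
    then show ?thesis using parallelogram[of "X m" "X n"] X(2)[of m] X(2)[of n] by simp
  qed
  have "Cauchy X"
  proof (rule CauchyI)
    fix e :: real assume "0 < e"
    then obtain N where N: "4 / e\<^sup>2 < real N" using reals_Archimedean2 by blast
    have "norm (X m - X n) < e" if "m \<ge> N" "n \<ge> N" for m n
    proof (rule power2_less_imp_less)
      have le: "2 / real (Suc k) \<le> 2 / real (Suc N)" if "k \<ge> N" for k
        using that by (intro divide_left_mono) auto
      have "(norm (X m - X n))\<^sup>2 \<le> 4 / Suc N"
        using gap[of m n] le[OF that(1)] le[OF that(2)] by simp
      also have "\<dots> < e\<^sup>2" using N \<open>0 < e\<close> zero_less_power[of e 2]
        by (simp add: field_simps add_strict_increasing)
      finally show "(norm (X m - X n))\<^sup>2 < e\<^sup>2" .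
    qed (use \<open>0 < e\<close> in simp)
    then show "\<exists>M. \<forall>m\<ge>M. \<forall>n\<ge>M. norm (X m - X n) < e" by blast
  qed
  then obtain u where u: "X \<longlonglongrightarrow> u" unfolding Cauchy_convergent_iff convergent_def by blast
  have "u \<in> K" using closed_sequentially[OF assms(1)] X(1) u by blast
  moreover have "(norm u)\<^sup>2 \<le> d"
  proof (rule LIMSEQ_le)
    show "(\<lambda>n. (norm (X n))\<^sup>2) \<longlonglongrightarrow> (norm u)\<^sup>2" by (intro tendsto_intros u)
    show "(\<lambda>n. d + 1 / Suc n) \<longlonglongrightarrow> d"
      using tendsto_add[OF tendsto_const LIMSEQ_inverse_real_of_nat, of d]
      by (simp add: inverse_eq_divide)
  qed (use X(2) less_imp_le in blast)
  ultimately show ?thesis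
    by (meson d_le norm_ge_zero order_trans power2_le_imp_le)
qed

text \<open>
  A nonzero functional \<open>\<phi>\<close> is represented by a multiple of the vector \<open>u\<close> of least norm on the affine
  hyperplane \<open>\<phi> = 1\<close>: minimality makes \<open>u\<close> orthogonal to the kernel of \<open>\<phi>\<close>, and every \<open>x\<close> is
  \<open>\<phi> x\<close> times \<open>u\<close> plus an element of that kernel.
\<close>

lemma Riesz_representation:
  assumes "bounded_linear \<phi>" and scl: "\<And>c x. \<phi> (scl c x) = c * \<phi> x"
  shows "\<exists>y. \<forall>x. \<phi> x = ip x y"
proof (cases "\<forall>x. \<phi> x = 0")
  case True
  then show ?thesis by (intro exI[of _ 0]) simp
next
  case False
  interpret \<phi>: bounded_linear \<phi> by fact
  from False obtain z where z: "\<phi> z \<noteq> 0" by blast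
  define K where "K = {x. \<phi> x = 1}"
  have "closed K"
    unfolding K_def by (intro closed_Collect_eq continuous_intros \<phi>.continuous_on)
  moreover have "convex K"
    by (auto simp: K_def convex_def \<phi>.add \<phi>.scaleR scaleR_left.add[symmetric])
  moreover have "scl (1 / \<phi> z) z \<in> K" using z by (simp add: K_def scl)
  ultimately obtain u where u: "\<phi> u = 1" and min: "\<And>x. \<phi> x = 1 \<Longrightarrow> norm u \<le> norm x"
    using min_norm_exists[of K] by (auto simp: K_def)
  have "u \<noteq> 0" using u by auto
  have orth: "ip k u = 0" if "\<phi> k = 0" for k
  proof (cases "k = 0")
    case False
    have "norm u \<le> norm (u - scl (ip u k / of_real ((norm k)\<^sup>2)) k)"
      by (rule min) (simp add: \<phi>.diff scl u that)
    then have "(norm u)\<^sup>2 \<le> (norm u)\<^sup>2 - (norm (ip u k))\<^sup>2 / (norm k)\<^sup>2"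
      unfolding norm_minus_projection[OF False, symmetric] by (rule power_mono) simp
    then have "ip u k = 0" using False by (simp add: divide_le_0_iff)
    then show ?thesis by (subst ip_commute) simp
  qed simp
  have "\<phi> x = ip x (scl (1 / of_real ((norm u)\<^sup>2)) u)" for x
  proof -
    have "ip (x - scl (\<phi> x) u) u = 0" by (rule orth) (simp add: \<phi>.diff scl u)
    then have "ip x u = \<phi> x * of_real ((norm u)\<^sup>2)"
      by (simp add: ip_diff_left ip_scl_left ip_self)
    moreover have "scnj (1 / of_real ((norm u)\<^sup>2)) = (1 / of_real ((norm u)\<^sup>2) :: 'k)"
      using scnj_of_real[of "1 / (norm u)\<^sup>2"] by simp
    ultimately show ?thesis using \<open>u \<noteq> 0\<close> by (simp add: ip_scl_right)
  qed
  then show ?thesis by blast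
qed

end

section \<open>Inverting operators by Neumann series\<close>

lemma norm_blinfun_power_le: "norm (blinfun_power D n) \<le> norm D ^ n"
proof (induction n)
  case (Suc n)
  have "norm (blinfun_power D (Suc n)) \<le> norm D * norm (blinfun_power D n)"
    by (simp add: norm_blinfun_compose)
  also have "\<dots> \<le> norm D * norm D ^ n"
    using Suc by (rule mult_left_mono) simp
  finally show ?case by simp
qed (simp add: norm_blinfun_id_le)

lemma blinfun_compose_assoc: "(a o\<^sub>L b) o\<^sub>L c = a o\<^sub>L (b o\<^sub>L c)"
  by (simp add: blinfun_eqI)

lemma blinfun_power_commutes: "blinfun_power D n o\<^sub>L D = D o\<^sub>L blinfun_power D n"
proof (induction n)
  case (Suc n)
  then show ?case by (simp add: blinfun_compose_assoc)
qed (simp add: blinfun_eqI)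

text \<open>
  Composing the series \<open>N\<close> of powers with \<open>D\<close> on either side drops its first term, so that
  \<open>D N = N D = N - id\<close>.
\<close>

lemma Neumann_series:
  fixes D :: "'a::banach \<Rightarrow>\<^sub>L 'a"
  assumes "norm D < 1"
  obtains N where "blinfun_power D sums N"
    and "(id_blinfun - D) o\<^sub>L N = id_blinfun" and "N o\<^sub>L (id_blinfun - D) = id_blinfun"
proof
  interpret comp: bounded_bilinear "(o\<^sub>L) :: ('a \<Rightarrow>\<^sub>L 'a) \<Rightarrow> ('a \<Rightarrow>\<^sub>L 'a) \<Rightarrow> ('a \<Rightarrow>\<^sub>L 'a)"
    by (rule bounded_bilinear_blinfun_compose)
  let ?N = "suminf (blinfun_power D)"
  have summ: "summable (blinfun_power D)"
    by (rule summable_comparison_test[of _ "\<lambda>n. norm D ^ n"])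
      (use assms norm_blinfun_power_le in auto)
  then show sums: "blinfun_power D sums ?N" by (rule summable_sums)
  have shift: "(\<lambda>n. blinfun_power D (Suc n)) sums (?N - id_blinfun)"
    using sums by (simp add: sums_Suc_iff del: blinfun_power.simps(2))
  have "D o\<^sub>L ?N = ?N - id_blinfun"
    using bounded_linear.sums[OF comp.bounded_linear_right sums, of D] shift by (simp add: sums_unique2)
  then show "(id_blinfun - D) o\<^sub>L ?N = id_blinfun"
    by (simp add: comp.diff_left) (simp add: blinfun_eqI)
  have "?N o\<^sub>L D = ?N - id_blinfun"
    using bounded_linear.sums[OF comp.bounded_linear_left sums, of D] shift
    by (simp add: blinfun_power_commutes sums_unique2)
  then show "?N o\<^sub>L (id_blinfun - D) = id_blinfun"
    by (simp add: comp.diff_right) (simp add: blinfun_eqI)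
qed

lemma blinfun_inverse_eqI:
  assumes "R o\<^sub>L S = id_blinfun" "S o\<^sub>L R = id_blinfun"
  shows "blinfun_inverse S = R"
  unfolding blinfun_inverse_def
proof (rule the_equality)
  fix R' assume R': "R' o\<^sub>L S = id_blinfun \<and> S o\<^sub>L R' = id_blinfun"
  have "R' y = R y" for y
    using R' assms by (metis blinfun_apply_blinfun_compose blinfun_apply_id_blinfun)
  then show "R' = R" by (rule blinfun_eqI)
qed (use assms in simp)

text \<open>
  If \<open>\<langle>S x, x\<rangle>\<close> is real and at least \<open>A \<parallel>x\<parallel>\<^sup>2\<close>, then for a small step \<open>t\<close>
  \<open>\<parallel>x - t S x\<parallel>\<^sup>2 \<le> (1 - 2 t A + t\<^sup>2 \<parallel>S\<parallel>\<^sup>2) \<parallel>x\<parallel>\<^sup>2\<close>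
  with a factor below 1, so that \<open>t S = id - (id - t S)\<close> is inverted by a Neumann series. The bound on
  the inverse follows from \<open>A \<parallel>x\<parallel> \<le> \<parallel>S x\<parallel>\<close>.
\<close>

lemma (in hilbert_space) coercive_invertible:
  fixes S :: "'h \<Rightarrow>\<^sub>L 'h"
  assumes "0 < A" and q: "\<And>x. ip (S x) x = of_real (q x)" "\<And>x. A * (norm x)\<^sup>2 \<le> q x"
  obtains R where "R o\<^sub>L S = id_blinfun" "S o\<^sub>L R = id_blinfun" "norm R \<le> 1 / A"
proof -
  \<comment> \<open>Any \<open>M\<close> that is at least both \<open>norm S\<close> and \<open>A\<close> would do: the second bound keeps the
    contraction factor \<open>1 - (A / M)\<^sup>2\<close> nonnegative, and \<open>t = A / M\<^sup>2\<close> minimizes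
    \<open>1 - 2 t A + t\<^sup>2 M\<^sup>2\<close>.\<close>
  define M where "M = norm S + A"
  have M: "0 < M" "A \<le> M" "norm S \<le> M" using \<open>0 < A\<close> by (auto simp: M_def add_nonneg_pos)
  define t where "t = A / M\<^sup>2"
  have t: "0 < t" using \<open>0 < A\<close> M by (simp add: t_def)
  define D where "D = id_blinfun - t *\<^sub>R S"
  have ratio: "0 \<le> 1 - (A / M)\<^sup>2" "1 - (A / M)\<^sup>2 < 1"
    using \<open>0 < A\<close> M by (simp_all add: power_divide power_mono)
  have "norm D \<le> sqrt (1 - (A / M)\<^sup>2)"
  proof (rule norm_blinfun_bound)
    fix x
    have D_x: "D x = x - t *\<^sub>R S x" by (simp add: D_def blinfun.bilinear_simps)
    have "(of_real ((norm (D x))\<^sup>2) :: 'k) = of_real ((norm x)\<^sup>2 - 2 * t * q x + t\<^sup>2 * (norm (S x))\<^sup>2)"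
    proof -
      have "ip x (S x) = of_real (q x)"
        by (subst ip_commute) (simp add: q(1) scnj_of_real)
      then show ?thesis
        unfolding D_x norm_diff_sq
        by (simp add: ip_scaleR_left ip_scaleR_right q(1) scaleR_conv_of_real power_mult_distrib)
    qed
    then have "(norm (D x))\<^sup>2 = (norm x)\<^sup>2 - 2 * t * q x + t\<^sup>2 * (norm (S x))\<^sup>2"
      by (simp only: of_real_eq_iff)
    also have "\<dots> \<le> (norm x)\<^sup>2 - 2 * t * (A * (norm x)\<^sup>2) + t\<^sup>2 * (M * norm x)\<^sup>2"
    proof (intro add_mono diff_mono mult_left_mono power_mono order_refl q(2))
      show "norm (S x) \<le> M * norm x"
        using norm_blinfun[of S x] mult_right_mono[OF M(3), of "norm x"] by simp
    qed (use t in auto)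
    also have "\<dots> = (1 - (A / M)\<^sup>2) * (norm x)\<^sup>2"
      using M(1) by (simp add: t_def field_simps power2_eq_square)
    finally show "norm (D x) \<le> sqrt (1 - (A / M)\<^sup>2) * norm x"
      by (metis norm_ge_zero real_le_rsqrt real_sqrt_mult real_sqrt_unique)
  qed (use ratio in simp)
  also have "\<dots> < 1" using ratio by simp
  finally have "norm D < 1" .
  then obtain N where N: "(id_blinfun - D) o\<^sub>L N = id_blinfun" "N o\<^sub>L (id_blinfun - D) = id_blinfun"
    by (rule Neumann_series)
  define R where "R = t *\<^sub>R N"
  have "R (S x) = x" "S (R x) = x" for x
    using N[THEN arg_cong, of "\<lambda>T. blinfun_apply T x"]
    by (simp_all add: R_def D_def blinfun.bilinear_simps)
  then have R: "R o\<^sub>L S = id_blinfun" "S o\<^sub>L R = id_blinfun"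
    by (simp_all add: blinfun_eqI)
  have "norm R \<le> 1 / A"
  proof (rule norm_blinfun_bound)
    fix y
    have "A * (norm (R y))\<^sup>2 \<le> norm (ip (S (R y)) (R y))"
      unfolding q(1) norm_of_real using q(2)[of "R y"] by linarith
    also have "\<dots> \<le> norm y * norm (R y)"
      using Cauchy_Schwarz \<open>S (R y) = y\<close> by metis
    finally have "A * norm (R y) \<le> norm y"
      by (cases "R y = 0") (simp_all add: power2_eq_square)
    then show "norm (R y) \<le> 1 / A * norm y"
      using \<open>0 < A\<close> by (simp add: field_simps)
  qed (use \<open>0 < A\<close> in simp)
  with R show ?thesis by (rule that)
qed

section \<open>Adjoints\<close>

locale hilbert_space_pair = H: hilbert_space sclH ipH + L: hilbert_space sclL ipL
  for sclH :: "'k::rc_field \<Rightarrow> 'h::banach \<Rightarrow> 'h" and ipH :: "'h \<Rightarrow> 'h \<Rightarrow> 'k"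
    and sclL :: "'k \<Rightarrow> 'l::banach \<Rightarrow> 'l" and ipL :: "'l \<Rightarrow> 'l \<Rightarrow> 'k"
begin

lemma hilbert_adjoint_eqI:
  assumes "\<And>x y. ipL (blinfun_apply T x) y = ipH x (blinfun_apply S y)"
  shows "hilbert_adjoint ipH ipL T = S"
  unfolding hilbert_adjoint_def
proof (rule the_equality)
  fix S' :: "'l \<Rightarrow>\<^sub>L 'h"
  assume "\<forall>x y. ipL (T x) y = ipH x (S' y)"
  then have "S' y = S y" for y
    by (intro H.eqI_ip) (simp add: assms[symmetric])
  then show "S' = S" by (rule blinfun_eqI)
qed (use assms in simp)

text \<open>
  The value of the adjoint at \<open>y\<close> is the Riesz representative of \<open>x \<mapsto> \<langle>T x, y\<rangle>\<close>. Homogeneity over the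
  whole scalar field has to be assumed, since bounded operators are only real-linear.
\<close>

lemma adjoint_exists:
  fixes T :: "'h \<Rightarrow>\<^sub>L 'l"
  assumes "\<And>c x. T (sclH c x) = sclL c (T x)"
  shows "\<exists>S :: 'l \<Rightarrow>\<^sub>L 'h. (\<forall>x y. ipL (T x) y = ipH x (blinfun_apply S y)) \<and> norm S \<le> norm T"
proof -
  have "\<exists>z. \<forall>x. ipL (T x) y = ipH x z" for y
  proof (rule H.Riesz_representation)
    show "bounded_linear (\<lambda>x. ipL (T x) y)"
      by (rule bounded_linear_compose[OF L.bounded_linear_ip_left blinfun.bounded_linear_right])
  qed (simp add: assms L.ip_scl_left)
  then obtain S where S: "\<And>x y. ipL (T x) y = ipH x (S y)" by metis
  have S_le: "norm (S y) \<le> norm T * norm y" for y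
  proof -
    have "(norm (S y))\<^sup>2 = norm (ipL (T (S y)) y)"
      by (simp add: S H.ip_self norm_power)
    also have "\<dots> \<le> norm (T (S y)) * norm y" by (rule L.Cauchy_Schwarz)
    also have "\<dots> \<le> norm T * norm (S y) * norm y"
      by (intro mult_right_mono norm_blinfun) simp
    finally show ?thesis
      by (cases "S y = 0") (simp_all add: power2_eq_square algebra_simps)
  qed
  have "bounded_linear S"
  proof (rule bounded_linear_intro[where K = "norm T"])
    show "S (y + z) = S y + S z" for y z
      by (rule H.eqI_ip) (simp add: S[symmetric] L.ip_add_right H.ip_add_right)
    show "S (r *\<^sub>R y) = r *\<^sub>R S y" for r y
      by (rule H.eqI_ip) (simp add: S[symmetric] L.ip_scaleR_right H.ip_scaleR_right)
    show "norm (S y) \<le> norm y * norm T" for y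
      using S_le[of y] by (simp add: mult.commute)
  qed
  then show ?thesis
    by (intro exI[of _ "Blinfun S"])
      (auto simp: bounded_linear_Blinfun_apply S S_le intro: norm_blinfun_bound)
qed

lemma
  fixes T :: "'h \<Rightarrow>\<^sub>L 'l"
  assumes "\<And>c x. T (sclH c x) = sclL c (T x)"
  shows ip_hilbert_adjoint: "ipL (T x) y = ipH x (hilbert_adjoint ipH ipL T y)"
    and norm_hilbert_adjoint_le: "norm (hilbert_adjoint ipH ipL T) \<le> norm T"
proof -
  from adjoint_exists[of T, OF assms] obtain S :: "'l \<Rightarrow>\<^sub>L 'h"
    where S: "\<And>x y. ipL (T x) y = ipH x (S y)" "norm S \<le> norm T" by blast
  have "hilbert_adjoint ipH ipL T = S"
    by (rule hilbert_adjoint_eqI) (rule S(1))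
  with S show "ipL (T x) y = ipH x (hilbert_adjoint ipH ipL T y)"
    and "norm (hilbert_adjoint ipH ipL T) \<le> norm T" by simp_all
qed

lemma hilbert_adjoint_diff:
  fixes T U :: "'h \<Rightarrow>\<^sub>L 'l"
  assumes "\<And>c x. T (sclH c x) = sclL c (T x)" "\<And>c x. U (sclH c x) = sclL c (U x)"
  shows "hilbert_adjoint ipH ipL (T - U) = hilbert_adjoint ipH ipL T - hilbert_adjoint ipH ipL U"
  by (rule hilbert_adjoint_eqI)
    (simp add: blinfun.diff_left L.ip_diff_left H.ip_diff_right ip_hilbert_adjoint assms)

lemma ip_adjoint_compose_self:
  fixes T :: "'h \<Rightarrow>\<^sub>L 'l"
  assumes "\<And>c x. T (sclH c x) = sclL c (T x)"
  shows "ipH ((hilbert_adjoint ipH ipL T o\<^sub>L T) x) x = of_real ((norm (T x))\<^sup>2)"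
proof -
  have "ipH ((hilbert_adjoint ipH ipL T o\<^sub>L T) x) x = scnj (ipL (T x) (T x))"
    by (subst H.ip_commute) (simp add: ip_hilbert_adjoint[OF assms])
  then show ?thesis by (simp add: L.ip_self scnj_of_real del: of_real_power)
qed

end

section \<open>Analysis operators and frame bounds\<close>

text \<open>
  The uniform boundedness principle in a convenient form. The closed sets \<open>norm (T x) \<le> n\<close> cover the
  complete space, so by Baire one of them contains a ball; subtracting its center gives a bound for
  \<open>T\<close> on a ball around 0.
\<close>

lemma bounded_linear_if_closed_sublevel_sets:
  fixes T :: "'h::banach \<Rightarrow> 'b::real_normed_vector"
  assumes "linear T" and closed: "\<And>n::nat. closed {x. norm (T x) \<le> n}"
  shows "bounded_linear T"
proof -
  interpret linear T by fact
  define C where "C n = {x. norm (T x) \<le> real n}" for n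
  have "(\<Union>n. C n) = UNIV"
    using real_arch_simple by (fastforce simp: C_def)
  then have "euclidean interior_of (\<Union>(range C)) \<noteq> {}" by simp
  then obtain n where "interior (C n) \<noteq> {}"
    using Baire_category_alt[OF disjI1[OF completely_metrizable_space_euclidean], of "range C"] closed
    by (auto simp: C_def)
  then obtain x r where r: "0 < r" "ball x r \<subseteq> C n"
    by (metis all_not_in_conv mem_interior)
  have near: "norm (T y) \<le> 2 * n" if "norm y < r" for y
  proof -
    have "x + y \<in> C n" "x \<in> C n" using r that by (auto simp: dist_norm subset_iff)
    then show ?thesis
      using norm_triangle_ineq4[of "T (x + y)" "T x"] by (simp add: C_def add)
  qed
  have "norm (T y) \<le> norm y * (4 * n / r)" for y
  proof (cases "y = 0")
    case False
    define s where "s = r / (2 * norm y)"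
    have s: "0 < s" "norm (s *\<^sub>R y) < r" using r False by (auto simp: s_def)
    have "s * norm (T y) \<le> 2 * n"
      using near[OF s(2)] s(1) by (simp add: scale)
    then show ?thesis using False r(1) by (simp add: s_def field_simps)
  qed (simp add: zero)
  then show ?thesis
    by (intro bounded_linear_intro[of _ "4 * n / r"]) (simp_all add: add scale)
qed

lemma ell2_norm_le_iff:
  assumes "0 \<le> c"
  shows "norm x \<le> c \<longleftrightarrow> (\<forall>F. finite F \<longrightarrow> L2_set (\<lambda>i. norm (ell2_apply x i)) F \<le> c)"
  using ell2_norm_ge_L2_set ell2_norm_leI[OF assms] order_trans by blast

text \<open>
  The norm of \<open>\<ell>\<^sup>2\<close> is a supremum of norms of finitely many coordinates, so its sublevel sets under \<open>T\<close>
  are intersections of closed sets. This is what makes the analysis operator of a family bounded as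
  soon as it is defined everywhere.
\<close>

lemma bounded_linear_into_ell2:
  fixes T :: "'h::banach \<Rightarrow> ('i, 'k::real_normed_vector) ell2"
  assumes "\<And>i. bounded_linear (\<lambda>x. ell2_apply (T x) i)"
  shows "bounded_linear T"
proof (rule bounded_linear_if_closed_sublevel_sets)
  have lin: "linear (\<lambda>x. ell2_apply (T x) i)" for i
    using assms by (rule bounded_linear.linear)
  show "linear T"
    by (rule linearI; rule ell2_apply_inject[THEN iffD1])
      (auto simp: fun_eq_iff plus_ell2.rep_eq scaleR_ell2.rep_eq linear_add[OF lin] linear_cmul[OF lin])
  fix n :: nat
  have "{x. norm (T x) \<le> n} = (\<Inter>F\<in>{F. finite F}. {x. L2_set (\<lambda>i. norm (ell2_apply (T x) i)) F \<le> n})"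
    by (auto simp: ell2_norm_le_iff)
  moreover have "closed {x. L2_set (\<lambda>i. norm (ell2_apply (T x) i)) F \<le> n}" for F
    unfolding L2_set_def
    by (intro closed_Collect_le continuous_intros bounded_linear.continuous_on[OF assms])
  ultimately show "closed {x. norm (T x) \<le> n}" by (simp add: closed_INT)
qed

context hilbert_space
begin

lemma blinfun_apply_analysis_op:
  assumes "\<And>x. square_summable (analysis_family ip w I f x)"
  shows "ell2_apply (analysis_op ip w I f x) = analysis_family ip w I f x"
proof -
  let ?T = "\<lambda>x. Abs_ell2 (analysis_family ip w I f x)"
  have T: "ell2_apply (?T x) = analysis_family ip w I f x" for x
    using assms by (simp add: Abs_ell2_inverse)
  have "bounded_linear (\<lambda>x. analysis_family ip w I f x i)" for i
    using bounded_linear_compose[OF bounded_linear_mult_right bounded_linear_ip_left]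
    by (cases "i \<in> I") (simp_all add: analysis_family_def)
  then have "bounded_linear ?T"
    by (intro bounded_linear_into_ell2) (simp add: T)
  then show ?thesis
    by (simp add: analysis_op_def bounded_linear_Blinfun_apply T)
qed

lemma analysis_op_scl:
  assumes "\<And>x. square_summable (analysis_family ip w I f x)"
  shows "analysis_op ip w I f (scl c x) = ell2_scale c (analysis_op ip w I f x)"
  by (rule ell2_apply_inject[THEN iffD1])
    (auto simp: fun_eq_iff blinfun_apply_analysis_op[OF assms] ell2_scale.rep_eq analysis_family_def
      ip_scl_left)

lemma norm_analysis_family:
  assumes "i \<in> I" "0 < w i"
  shows "(norm (analysis_family ip w I f x i))\<^sup>2 = w i * (norm (ip x (f i)))\<^sup>2"
  using assms by (simp add: analysis_family_def norm_mult power_mult_distrib)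

lemma square_summable_analysis_family_iff:
  assumes "\<And>i. i \<in> I \<Longrightarrow> 0 < w i"
  shows "square_summable (analysis_family ip w I f x)
    \<longleftrightarrow> (\<lambda>i. w i * (norm (ip x (f i)))\<^sup>2) summable_on I"
  unfolding square_summable_def
  by (rule summable_on_cong_neutral)
    (auto simp: norm_analysis_family assms, auto simp: analysis_family_def)

lemma frame_sum_eq_norm_analysis_op:
  assumes sq: "\<And>x. square_summable (analysis_family ip w I f x)"
    and w: "\<And>i. i \<in> I \<Longrightarrow> 0 < w i"
  shows "(\<Sum>\<^sub>\<infinity>i\<in>I. ennreal (w i * (norm (ip x (f i)))\<^sup>2)) = ennreal ((norm (analysis_op ip w I f x))\<^sup>2)"
proof -
  have "(norm (analysis_op ip w I f x))\<^sup>2 = (\<Sum>\<^sub>\<infinity>i. (norm (analysis_family ip w I f x i))\<^sup>2)"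
    unfolding norm_ell2_def blinfun_apply_analysis_op[OF sq] by (simp add: infsum_nonneg)
  also have "\<dots> = (\<Sum>\<^sub>\<infinity>i\<in>I. w i * (norm (ip x (f i)))\<^sup>2)"
    by (rule infsum_cong_neutral) (auto simp: norm_analysis_family w, auto simp: analysis_family_def)
  finally have "(norm (analysis_op ip w I f x))\<^sup>2 = (\<Sum>\<^sub>\<infinity>i\<in>I. w i * (norm (ip x (f i)))\<^sup>2)" .
  moreover have "(\<lambda>i. w i * (norm (ip x (f i)))\<^sup>2) summable_on I"
    using sq[of x] square_summable_analysis_family_iff[of I w f x] w by blast
  ultimately show ?thesis
    using w by (simp add: infsum_ennreal less_imp_le)
qed

lemma ar_frame_square_summable:
  assumes "ar_frame ip w I P f A B"
  shows "square_summable (analysis_family ip w I f x)"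
proof -
  have I: "I = (\<Union>k. P k)" "disjoint_family P" and w: "\<And>i. i \<in> I \<Longrightarrow> 0 < w i"
    and bound: "(\<Sum>k. \<Sum>\<^sub>\<infinity>i\<in>P k. ennreal (w i * (norm (ip x (f i)))\<^sup>2)) \<le> ennreal (B * (norm x)\<^sup>2)"
    using assms unfolding ar_frame_def by blast+
  have "(\<lambda>i. w i * (norm (ip x (f i)))\<^sup>2) summable_on I"
  proof (rule summable_on_infsum_ennreal_finite)
    show "(\<Sum>\<^sub>\<infinity>i\<in>I. ennreal (w i * (norm (ip x (f i)))\<^sup>2)) \<le> ennreal (B * (norm x)\<^sup>2)"
      using bound unfolding suminf_infsum_ennreal[OF I(2)] I(1) .
  qed (use w in \<open>simp add: less_imp_le\<close>)
  then show ?thesis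
    using square_summable_analysis_family_iff[of I w f x] w by blast
qed

text \<open>
  An AR-frame is a family whose analysis operator is bounded above and below. In this form the frame
  bounds are perturbed by the triangle inequality alone.
\<close>

lemma ar_frame_iff:
  assumes sq: "\<And>x. square_summable (analysis_family ip w I f x)"
  shows "ar_frame ip w I P f A B \<longleftrightarrow>
    countable I \<and> (\<forall>i\<in>I. 0 < w i) \<and> I = (\<Union>k. P k) \<and> disjoint_family P \<and> 0 < A \<and> 0 < B \<and>
    (\<forall>x. sqrt A * norm x \<le> norm (analysis_op ip w I f x) \<and>
         norm (analysis_op ip w I f x) \<le> sqrt B * norm x)"
proof -
  have sums: "(\<Sum>k. \<Sum>\<^sub>\<infinity>i\<in>P k. ennreal (w i * (norm (ip x (f i)))\<^sup>2))
      = ennreal ((norm (analysis_op ip w I f x))\<^sup>2)"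
    if "\<forall>i\<in>I. 0 < w i" "I = (\<Union>k. P k)" "disjoint_family P" for x
    using frame_sum_eq_norm_analysis_op[of w I f, OF sq] that by (simp add: suminf_infsum_ennreal)
  have lower: "c * (norm x)\<^sup>2 \<le> (norm y)\<^sup>2 \<longleftrightarrow> sqrt c * norm x \<le> norm y"
    and upper: "(norm y)\<^sup>2 \<le> c * (norm x)\<^sup>2 \<longleftrightarrow> norm y \<le> sqrt c * norm x"
    if "0 < c" for c and x :: 'h and y :: "('b, 'k) ell2"
  proof -
    have c: "c * (norm x)\<^sup>2 = (sqrt c * norm x)\<^sup>2"
      using that by (simp add: power_mult_distrib)
    show "c * (norm x)\<^sup>2 \<le> (norm y)\<^sup>2 \<longleftrightarrow> sqrt c * norm x \<le> norm y"
      and "(norm y)\<^sup>2 \<le> c * (norm x)\<^sup>2 \<longleftrightarrow> norm y \<le> sqrt c * norm x"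
      using that unfolding c by (intro power_mono_iff; simp)+
  qed
  have key: "(ennreal (A * (norm x)\<^sup>2) \<le> (\<Sum>k. \<Sum>\<^sub>\<infinity>i\<in>P k. ennreal (w i * (norm (ip x (f i)))\<^sup>2)) \<and>
      (\<Sum>k. \<Sum>\<^sub>\<infinity>i\<in>P k. ennreal (w i * (norm (ip x (f i)))\<^sup>2)) \<le> ennreal (B * (norm x)\<^sup>2)) \<longleftrightarrow>
      sqrt A * norm x \<le> norm (analysis_op ip w I f x) \<and>
      norm (analysis_op ip w I f x) \<le> sqrt B * norm x"
    if "\<forall>i\<in>I. 0 < w i" "I = (\<Union>k. P k)" "disjoint_family P" "0 < A" "0 < B" for x
    unfolding sums[OF that(1-3)] using that(4,5)
    by (simp add: ennreal_le_iff lower upper less_imp_le)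
  show ?thesis
  proof (cases "(\<forall>i\<in>I. 0 < w i) \<and> I = (\<Union>k. P k) \<and> disjoint_family P \<and> 0 < A \<and> 0 < B")
    case True
    then have "0 < A" "0 < B" and *: "\<forall>i\<in>I. 0 < w i" "I = (\<Union>k. P k)" "disjoint_family P"
      by blast+
    show ?thesis
      unfolding ar_frame_def key[OF * \<open>0 < A\<close> \<open>0 < B\<close>] by (rule refl)
  next
    case False
    then show ?thesis unfolding ar_frame_def by argo
  qed
qed

end

section \<open>Perturbation of AR-frames\<close>

theorem proposition2p6:
  fixes scl :: "'k::rc_field \<Rightarrow> 'h::banach \<Rightarrow> 'h"
    and ip :: "'h \<Rightarrow> 'h \<Rightarrow> 'k"
    and w :: "'i \<Rightarrow> real" and I :: "'i set" and P :: "nat \<Rightarrow> 'i set"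
    and f g :: "'i \<Rightarrow> 'h" and A B :: real
    and H :: "nat \<Rightarrow> 'h set"
    and T1 T2 E :: "'h \<Rightarrow>\<^sub>L ('i, 'k) ell2"
    and T1s T2s Es :: "('i, 'k) ell2 \<Rightarrow>\<^sub>L 'h"
    and Sf Sg \<Delta>S :: "'h \<Rightarrow>\<^sub>L 'h"
    and Rf Rg :: "('i, 'k) ell2 \<Rightarrow>\<^sub>L 'h"
  assumes hilbert: "hilbert_space scl ip"
    and separable: "separable_space (euclidean :: 'h topology)"
    and f_frame: "ar_frame ip w I P f A B"
    and H_def: "H = (\<lambda>k. closure (module.span scl (f ` P k)))"
    and decomposition: "orthogonal_decomposition ip H"
    and block_frames: "\<And>k. is_frame_for ip (P k) f (H k)"
    and g_square_summable: "\<And>x. square_summable (analysis_family ip w I g x)"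
    and T1_def: "T1 = analysis_op ip w I f"
    and T2_def: "T2 = analysis_op ip w I g"
    and E_def: "E = T1 - T2"
    and T1s_def: "T1s = hilbert_adjoint ip ell2_ip T1"
    and T2s_def: "T2s = hilbert_adjoint ip ell2_ip T2"
    and Es_def: "Es = hilbert_adjoint ip ell2_ip E"
    and Sf_def: "Sf = T1s o\<^sub>L T1"
    and Sg_def: "Sg = T2s o\<^sub>L T2"
    and \<Delta>S_def: "\<Delta>S = Sg - Sf"
    and Rf_def: "Rf = blinfun_inverse Sf o\<^sub>L T1s"
    and Rg_def: "Rg = blinfun_inverse Sg o\<^sub>L T2s"
  shows "(norm E < sqrt A \<longrightarrow>
            ar_frame ip w I P g ((sqrt A - norm E)\<^sup>2) ((sqrt B + norm E)\<^sup>2)) \<and>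
         (norm E < sqrt A \<and> norm E < sqrt (B + A) - sqrt B \<longrightarrow>
            (\<lambda>n. blinfun_power (- (blinfun_inverse Sf o\<^sub>L \<Delta>S)) n
                   o\<^sub>L (Rf - (blinfun_inverse Sf o\<^sub>L Es))) sums Rg)"
proof -
  interpret hilbert_space scl ip by (rule hilbert)
  interpret hilbert_space_pair scl ip ell2_scale ell2_ip
    by unfold_locales
  have f_square_summable: "square_summable (analysis_family ip w I f x)" for x
    using f_frame by (rule ar_frame_square_summable)
  have frame: "0 < A" "0 < B" "countable I" "\<forall>i\<in>I. 0 < w i" "I = (\<Union>k. P k)" "disjoint_family P"
    and T1_lower: "sqrt A * norm x \<le> norm (T1 x)" and T1_upper: "norm (T1 x) \<le> sqrt B * norm x" for x
    using f_frame unfolding ar_frame_iff[OF f_square_summable] T1_def[symmetric] by blast+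
  define e where "e = norm E"
  have "0 \<le> e" by (simp add: e_def)
  have E_x: "E x = T1 x - T2 x" for x
    by (simp add: E_def blinfun.diff_left)
  have E_le: "norm (T1 x - T2 x) \<le> e * norm x" for x
    using norm_blinfun[of E x] by (simp add: E_x e_def)
  have T2_lower: "(sqrt A - e) * norm x \<le> norm (T2 x)" for x
    using T1_lower[of x] E_le[of x] norm_triangle_ineq2[of "T1 x" "T2 x"]
    by (simp add: left_diff_distrib)
  have T2_upper: "norm (T2 x) \<le> (sqrt B + e) * norm x" for x
    using T1_upper[of x] E_le[of x] norm_triangle_ineq2[of "T2 x" "T1 x"]
    by (simp add: distrib_right norm_minus_commute)

  have part_i: "ar_frame ip w I P g ((sqrt A - e)\<^sup>2) ((sqrt B + e)\<^sup>2)" if "e < sqrt A"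
  proof -
    have "0 < sqrt B + e" using \<open>0 < B\<close> \<open>0 \<le> e\<close> by (simp add: add_pos_nonneg)
    then show ?thesis
      unfolding ar_frame_iff[OF g_square_summable] T2_def[symmetric]
      using frame T2_lower T2_upper that \<open>0 \<le> e\<close> by simp
  qed

  have part_ii: "(\<lambda>n. blinfun_power (- (blinfun_inverse Sf o\<^sub>L \<Delta>S)) n
      o\<^sub>L (Rf - (blinfun_inverse Sf o\<^sub>L Es))) sums Rg"
    if "e < sqrt (B + A) - sqrt B"
  proof -
    have T1_scl: "T1 (scl c x) = ell2_scale c (T1 x)" and T2_scl: "T2 (scl c x) = ell2_scale c (T2 x)" for c x
      unfolding T1_def T2_def
      by (rule analysis_op_scl, fact f_square_summable, rule analysis_op_scl, fact g_square_summable)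
    have E_scl: "E (scl c x) = ell2_scale c (E x)" for c x
      by (simp add: E_x T1_scl T2_scl ell2.scale_right_diff_distrib)
    have T2s: "T2s = T1s - Es"
      using hilbert_adjoint_diff[of T1 E, OF T1_scl E_scl]
      by (simp add: E_def T1s_def T2s_def Es_def)
    have T2: "T2 = T1 - E" by (simp add: E_def)
    have T1_norm: "norm T1 \<le> sqrt B"
      using T1_upper \<open>0 < B\<close> by (intro norm_blinfun_bound) auto
    have T1s_norm: "norm T1s \<le> sqrt B"
      using norm_hilbert_adjoint_le[of T1, OF T1_scl] T1_norm by (simp add: T1s_def)
    have Es_norm: "norm Es \<le> e"
      using norm_hilbert_adjoint_le[of E, OF E_scl] by (simp add: Es_def e_def)

    \<comment> \<open>The lower frame bound is the coercivity of \<open>Sf\<close>.\<close>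
    obtain R where R: "R o\<^sub>L Sf = id_blinfun" "Sf o\<^sub>L R = id_blinfun" "norm R \<le> 1 / A"
    proof (rule coercive_invertible[of A Sf "\<lambda>x. (norm (T1 x))\<^sup>2"])
      show "ip (Sf x) x = of_real ((norm (T1 x))\<^sup>2)" for x
        unfolding Sf_def T1s_def by (rule ip_adjoint_compose_self) (rule T1_scl)
      show "A * (norm x)\<^sup>2 \<le> (norm (T1 x))\<^sup>2" for x
        using power_mono[OF T1_lower[of x], of 2] \<open>0 < A\<close> by (simp add: power_mult_distrib)
    qed (use \<open>0 < A\<close> in auto)
    have inv_Sf: "blinfun_inverse Sf = R" by (rule blinfun_inverse_eqI[OF R(1,2)])

    have "norm \<Delta>S \<le> 2 * sqrt B * e + e\<^sup>2"
    proof -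
      have \<Delta>S: "\<Delta>S = (Es o\<^sub>L E) - (T1s o\<^sub>L E) - (Es o\<^sub>L T1)"
        unfolding \<Delta>S_def Sf_def Sg_def T2 T2s
        by (rule blinfun_eqI) (simp add: blinfun.bilinear_simps)
      have "norm \<Delta>S \<le> norm (Es o\<^sub>L E) + norm (T1s o\<^sub>L E) + norm (Es o\<^sub>L T1)"
        unfolding \<Delta>S by (meson add_right_mono norm_triangle_ineq4 order_trans)
      also have "\<dots> \<le> e * e + sqrt B * e + e * sqrt B"
        using \<open>0 \<le> e\<close> \<open>0 < B\<close> T1_norm T1s_norm Es_norm
        by (intro add_mono order_trans[OF norm_blinfun_compose] mult_mono) (auto simp: e_def)
      finally show ?thesis by (simp only: power2_eq_square mult_2 distrib_right) (simp add: mult.commute)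
    qed
    \<comment> \<open>This is exactly what the bound on \<open>e\<close> says: adding \<open>B\<close> completes the square
      \<open>(sqrt B + e)\<^sup>2 < B + A\<close>.\<close>
    also have "\<dots> < A"
    proof -
      have "(sqrt B + e)\<^sup>2 < (sqrt (B + A))\<^sup>2"
        using that \<open>0 \<le> e\<close> \<open>0 < B\<close> by (intro power_strict_mono) auto
      then show ?thesis using \<open>0 < A\<close> \<open>0 < B\<close> by (simp add: power2_sum)
    qed
    finally have \<Delta>S_less: "norm \<Delta>S < A" .

    define D where "D = - (R o\<^sub>L \<Delta>S)"
    have "norm D < 1"
    proof -
      have "norm D \<le> norm R * norm \<Delta>S"
        by (simp add: D_def norm_blinfun_compose)
      also have "\<dots> \<le> 1 / A * norm \<Delta>S" using R(3) by (rule mult_right_mono) simp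
      also have "\<dots> < 1" using \<Delta>S_less \<open>0 < A\<close> by simp
      finally show ?thesis .
    qed
    then obtain N where N: "blinfun_power D sums N"
        "(id_blinfun - D) o\<^sub>L N = id_blinfun" "N o\<^sub>L (id_blinfun - D) = id_blinfun"
      by (rule Neumann_series)

    have R_Sf: "R (Sf x) = x" and Sf_R: "Sf (R x) = x" for x
      using R(1,2)[THEN arg_cong, of "\<lambda>T. blinfun_apply T x"] by simp_all
    have Sg: "Sg = Sf o\<^sub>L (id_blinfun - D)"
      by (rule blinfun_eqI) (simp add: D_def \<Delta>S_def blinfun.bilinear_simps Sf_R)
    have inv_Sg: "blinfun_inverse Sg = N o\<^sub>L R"
    proof (rule blinfun_inverse_eqI)
      have "(N o\<^sub>L R) o\<^sub>L Sg = N o\<^sub>L (id_blinfun - D)"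
        unfolding Sg by (rule blinfun_eqI) (simp add: R_Sf)
      then show "(N o\<^sub>L R) o\<^sub>L Sg = id_blinfun" by (simp only: N(3))
      have "Sg o\<^sub>L (N o\<^sub>L R) = Sf o\<^sub>L ((id_blinfun - D) o\<^sub>L N) o\<^sub>L R"
        unfolding Sg blinfun_compose_assoc ..
      then show "Sg o\<^sub>L (N o\<^sub>L R) = id_blinfun"
        unfolding N(2) by (simp add: blinfun_eqI Sf_R)
    qed
    have "Rf - (R o\<^sub>L Es) = R o\<^sub>L T2s"
      by (rule blinfun_eqI) (simp add: Rf_def inv_Sf T2s blinfun.bilinear_simps)
    then have "N o\<^sub>L (Rf - (R o\<^sub>L Es)) = Rg"
      by (simp add: Rg_def inv_Sg blinfun_compose_assoc)
    then show ?thesis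
      using bounded_linear.sums[OF
          bounded_bilinear.bounded_linear_left[OF bounded_bilinear_blinfun_compose] N(1)]
      unfolding inv_Sf D_def[symmetric] by metis
  qed
  show ?thesis
    using part_i part_ii unfolding e_def by blast
qed

end
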